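(* Let the stopping model $\mathcal{N}=\{N_\eta: h_{N_\eta},\ \eta\in[\eta_0,\infty)\}$ be uniparametric and closed under pgf composition, parametrized by $\eta=-\log\Pr(N_\eta=1)$. Then the four combined transformations yield only (at most) two distinct model extensions, namely, for every statistical model $\mathcal{X}$, 1. $\mathcal{Y}_1(\mathcal{X})=max^{-1}_{\mathcal{N}}(max_{\mathcal{N}}(\mathcal{X}))=max_{\mathcal{N}}(max^{-1}_{\mathcal{N}}(\mathcal{X}))$, and 2. $\mathcal{Y}_2(\mathcal{X})=min^{-1}_{\mathcal{N}}(min_{\mathcal{N}}(\mathcal{X}))=min_{\mathcal{N}}(min^{-1}_{\mathcal{N}}(\mathcal{X}))$, and these two extensions are both statistically stable. Furthermore, for every statistical model $\mathcal{X}$: (a) the model $\mathcal{Y}_1(\mathcal{X})$ is invariant under $max_{\mathcal{N}}(\cdot)$ and under $max^{-1}_{\mathcal{N}}(\cdot)$; (b) the model $\mathcal{Y}_2(\mathcal{X})$ is invariant under $min_{\mathcal{N}}(\cdot)$ and under $min^{-1}_{\mathcal{N}}(\cdot)$; and (c) each of the basic transformations $max_{\mathcal{N}}(\cdot)$, $max^{-1}_{\mathcal{N}}(\cdot)$, $min_{\mathcal{N}}(\cdot)$, $min^{-1}_{\mathcal{N}}(\cdot)$ is a restricted version of one of these two extensions.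
   Context: A statistical model $\mathcal{X}=\{X_\theta:\theta\in\Theta\}$ is a family of real random variables, identified with the set of their cumulative distribution functions $F_{X_\theta}$. Models are compared as sets of distributions. A stopping model $\mathcal{N}=\{N_\delta:\delta\in\mathcal{D}\}$ is a family of positive integer valued random variables ($\Pr(N_\delta=0)=0$), with probability generating functions (pgfs) $h_{N_\delta}(t)=\sum_{i\ge1}p_i(\delta)t^i$, $p_i(\delta)=\Pr(N_\delta=i)$, $t\in[0,1]$. Each $h_{N_\delta}$ is an increasing bijection of $[0,1]$ with inverse $h_{N_\delta}^{-1}$, and $\overline{h}_{N_\delta}(t)=1-h_{N_\delta}(1-t)$ is its conjugate, with inverse $\overline{h}_{N_\delta}^{-1}$. $\mathcal{N}$ is closed under pgf composition if for all $N_{\delta_1},N_{\delta_2}\in\mathcal{N}$ the random variable with pgf $h_{N_{\delta_1}}\circ h_{N_{\delta_2}}$ belongs to $\mathcal{N}$. $\mathcal{N}$ is "uniparametric and closed under pgf composition" if it is closed under pgf composition and has a parametrization $\delta\in\mathcal{D}$ in which every $p_i(\delta)$ is continuously differentiable in $\delta$ and $\mathcal{D}$ is a connected subset of $\mathbb{R}$ with non-empty interior. By the paper's standing convention such models are parametrized by $\eta=-\log\Pr(N_\eta=1)$ (with $\Pr(N_\eta=1)>0$), with parameter space $[\eta_0,\infty)$, $\eta_0\ge0$, each $\eta$ corresponding to exactly one distribution in $\mathcal{N}$. Basic transformations: $max_{\mathcal{N}}(\mathcal{X})$, $max^{-1}_{\mathcal{N}}(\mathcal{X})$, $min_{\mathcal{N}}(\mathcal{X})$,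 $min^{-1}_{\mathcal{N}}(\mathcal{X})$ are the models consisting of the random variables with cdfs, respectively, $h_{N_\eta}(F_{X_\theta})$, $h^{-1}_{N_\eta}(F_{X_\theta})$, $\overline{h}_{N_\eta}(F_{X_\theta})$, $\overline{h}^{-1}_{N_\eta}(F_{X_\theta})$, for $\theta\in\Theta$ and $\eta\in[\eta_0,\infty)$. Combined transformations: $max_{\mathcal{N}}(max^{-1}_{\mathcal{N}}(\mathcal{X}))$, $max^{-1}_{\mathcal{N}}(max_{\mathcal{N}}(\mathcal{X}))$, $min_{\mathcal{N}}(min^{-1}_{\mathcal{N}}(\mathcal{X}))$, $min^{-1}_{\mathcal{N}}(min_{\mathcal{N}}(\mathcal{X}))$ consist of the random variables with cdfs, respectively, $h_{N_{\eta_2}}\circ h^{-1}_{N_{\eta_1}}(F_{X_\theta})$, $h^{-1}_{N_{\eta_2}}\circ h_{N_{\eta_1}}(F_{X_\theta})$, $\overline{h}_{N_{\eta_2}}\circ\overline{h}^{-1}_{N_{\eta_1}}(F_{X_\theta})$, $\overline{h}^{-1}_{N_{\eta_2}}\circ\overline{h}_{N_{\eta_1}}(F_{X_\theta})$, for $\theta\in\Theta$ and $\eta_1,\eta_2\in[\eta_0,\infty)$. A model transformation $\mathcal{T}$ is a model extension if $\mathcal{X}\subseteq\mathcal{T}(\mathcal{X})$ for all $\mathcal{X}$; $\mathcal{X}$ is invariant under $\mathcal{T}$ if $\mathcal{T}(\mathcal{X})=\mathcal{X}$; $\mathcal{T}$ is statistically stable if $\mathcal{T}(\mathcal{T}(\mathcal{X}))=\mathcal{T}(\mathcal{X})$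 for every statistical model $\mathcal{X}$. "Restricted version": under these hypotheses, $H_{\mathcal{N},\eta}=h_{N_{\eta_1}}\circ h_{N_{\eta_2}}^{-1}$ with $\eta_1,\eta_2\ge\eta_0$ depends only on $\eta=\eta_1-\eta_2\in\mathbb{R}$; put $\overline{H}_{\mathcal{N},\eta}(t)=1-H_{\mathcal{N},\eta}(1-t)$. The extension $\mathcal{Y}_1(\mathcal{X})$ (resp. $\mathcal{Y}_2(\mathcal{X})$) is the family with cdfs $H_{\mathcal{N},\eta}(F_{X_\theta})$ (resp. $\overline{H}_{\mathcal{N},\eta}(F_{X_\theta})$), $\theta\in\Theta$, $\eta\in\mathbb{R}$. A transformation is a restricted version of one of these if, for every $\mathcal{X}$, it is obtained by letting $\eta$ range only over a semi-line of $\mathbb{R}$ ($\eta\ge\eta_0$ for $max_{\mathcal{N}}$ and $min_{\mathcal{N}}$; $\eta\le-\eta_0$ for $max^{-1}_{\mathcal{N}}$ and $min^{-1}_{\mathcal{N}}$). *)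

theory Defs
  imports "HOL-Probability.Probability"
begin

text \<open>A statistical model is the set of cumulative distribution functions of its real random
  variables, so that equality of models is equality of sets of distributions.\<close>

type_synonym model = "(real \<Rightarrow> real) set"

definition stat_model :: "model \<Rightarrow> bool" where
  "stat_model X \<longleftrightarrow> (\<forall>F\<in>X. \<exists>M. real_distribution M \<and> F = cdf M)"

definition model_transformation :: "(model \<Rightarrow> model) \<Rightarrow> bool" where
  "model_transformation T \<longleftrightarrow> (\<forall>X. stat_model X \<longrightarrow> stat_model (T X))"

definition model_extension :: "(model \<Rightarrow> model) \<Rightarrow> bool" where
  "model_extension T \<longleftrightarrow> model_transformation T \<and> (\<forall>X. stat_model X \<longrightarrow> X \<subseteq> T X)"

definition invariant_under :: "model \<Rightarrow> (model \<Rightarrow> model) \<Rightarrow> bool" where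
  "invariant_under X T \<longleftrightarrow> T X = X"

definition statistically_stable :: "(model \<Rightarrow> model) \<Rightarrow> bool" where
  "statistically_stable T \<longleftrightarrow> (\<forall>X. stat_model X \<longrightarrow> T (T X) = T X)"

definition pgf :: "nat pmf \<Rightarrow> real \<Rightarrow> real" where
  "pgf p t = (\<Sum>i. pmf p i * t ^ i)"

definition conj_pgf :: "nat pmf \<Rightarrow> real \<Rightarrow> real" where
  "conj_pgf p t = 1 - pgf p (1 - t)"

text \<open>The inverses are those of bijections of the unit interval and are only meaningful there.\<close>

definition pgf_inv :: "nat pmf \<Rightarrow> real \<Rightarrow> real" where
  "pgf_inv p = inv_into {0..1} (pgf p)"

definition conj_pgf_inv :: "nat pmf \<Rightarrow> real \<Rightarrow> real" where
  "conj_pgf_inv p = inv_into {0..1} (conj_pgf p)"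

definition stopping_model :: "nat pmf set \<Rightarrow> bool" where
  "stopping_model S \<longleftrightarrow> (\<forall>p\<in>S. pmf p 0 = 0)"

definition closed_under_pgf_composition :: "nat pmf set \<Rightarrow> bool" where
  "closed_under_pgf_composition S \<longleftrightarrow>
     (\<forall>p\<in>S. \<forall>q\<in>S. \<exists>r\<in>S. \<forall>t\<in>{0..1}. pgf r t = pgf p (pgf q t))"

text \<open>The parameter set may contain its endpoints, so derivatives are taken within it.\<close>

definition uniparametric :: "nat pmf set \<Rightarrow> bool" where
  "uniparametric S \<longleftrightarrow>
     (\<exists>(D :: real set) (P :: real \<Rightarrow> nat pmf).
        connected D \<and> interior D \<noteq> {} \<and> S = P ` D \<and>
        (\<forall>i. \<exists>p'. continuous_on D p' \<and>
           (\<forall>\<delta>\<in>D. ((\<lambda>d. pmf (P d) i) has_real_derivative p' \<delta>) (at \<delta> within D))))"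

text \<open>The parametrization \<open>\<eta> = -log Pr(N\<^sub>\<eta> = 1)\<close> with parameter space \<open>[\<eta>\<^sub>0, \<infinity>)\<close>.
  The values of \<open>N\<close> below \<open>\<eta>\<^sub>0\<close> are irrelevant.\<close>

definition eta_parametrized :: "(real \<Rightarrow> nat pmf) \<Rightarrow> real \<Rightarrow> bool" where
  "eta_parametrized N \<eta>0 \<longleftrightarrow>
     0 \<le> \<eta>0 \<and> (\<forall>\<eta>\<ge>\<eta>0. 0 < pmf (N \<eta>) 1 \<and> \<eta> = - ln (pmf (N \<eta>) 1))"

definition max_trans :: "(real \<Rightarrow> nat pmf) \<Rightarrow> real \<Rightarrow> model \<Rightarrow> model" where
  "max_trans N \<eta>0 X = {\<lambda>x. pgf (N \<eta>) (F x) | \<eta> F. \<eta>0 \<le> \<eta> \<and> F \<in> X}"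

definition max_inv_trans :: "(real \<Rightarrow> nat pmf) \<Rightarrow> real \<Rightarrow> model \<Rightarrow> model" where
  "max_inv_trans N \<eta>0 X = {\<lambda>x. pgf_inv (N \<eta>) (F x) | \<eta> F. \<eta>0 \<le> \<eta> \<and> F \<in> X}"

definition min_trans :: "(real \<Rightarrow> nat pmf) \<Rightarrow> real \<Rightarrow> model \<Rightarrow> model" where
  "min_trans N \<eta>0 X = {\<lambda>x. conj_pgf (N \<eta>) (F x) | \<eta> F. \<eta>0 \<le> \<eta> \<and> F \<in> X}"

definition min_inv_trans :: "(real \<Rightarrow> nat pmf) \<Rightarrow> real \<Rightarrow> model \<Rightarrow> model" where
  "min_inv_trans N \<eta>0 X = {\<lambda>x. conj_pgf_inv (N \<eta>) (F x) | \<eta> F. \<eta>0 \<le> \<eta> \<and> F \<in> X}"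

text \<open>\<open>H_fun N \<eta>0 \<eta>\<close> is \<open>h\<^bsub>\<eta>1\<^esub> \<circ> h\<^bsub>\<eta>2\<^esub>\<^sup>-\<^sup>1\<close> for any
  \<open>\<eta>1, \<eta>2 \<ge> \<eta>\<^sub>0\<close> with \<open>\<eta> = \<eta>1 - \<eta>2\<close>. It is determined only if this value does not
  depend on the choice of \<open>\<eta>1\<close> and \<open>\<eta>2\<close>.\<close>

definition H_fun :: "(real \<Rightarrow> nat pmf) \<Rightarrow> real \<Rightarrow> real \<Rightarrow> real \<Rightarrow> real" where
  "H_fun N \<eta>0 \<eta> t =
     (THE y. \<exists>\<eta>1\<ge>\<eta>0. \<exists>\<eta>2\<ge>\<eta>0. \<eta> = \<eta>1 - \<eta>2 \<and> y = pgf (N \<eta>1) (pgf_inv (N \<eta>2) t))"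

definition conj_H_fun :: "(real \<Rightarrow> nat pmf) \<Rightarrow> real \<Rightarrow> real \<Rightarrow> real \<Rightarrow> real" where
  "conj_H_fun N \<eta>0 \<eta> t = 1 - H_fun N \<eta>0 \<eta> (1 - t)"

text \<open>The set \<open>R\<close> of admitted \<open>\<eta>\<close> is a semi-line for the restricted versions of the
  extensions and \<open>UNIV\<close> for the extensions themselves.\<close>

definition Y1_on :: "real set \<Rightarrow> (real \<Rightarrow> nat pmf) \<Rightarrow> real \<Rightarrow> model \<Rightarrow> model" where
  "Y1_on R N \<eta>0 X = {\<lambda>x. H_fun N \<eta>0 \<eta> (F x) | \<eta> F. \<eta> \<in> R \<and> F \<in> X}"

definition Y2_on :: "real set \<Rightarrow> (real \<Rightarrow> nat pmf) \<Rightarrow> real \<Rightarrow> model \<Rightarrow> model" where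
  "Y2_on R N \<eta>0 X = {\<lambda>x. conj_H_fun N \<eta>0 \<eta> (F x) | \<eta> F. \<eta> \<in> R \<and> F \<in> X}"

abbreviation Y1 :: "(real \<Rightarrow> nat pmf) \<Rightarrow> real \<Rightarrow> model \<Rightarrow> model" where
  "Y1 \<equiv> Y1_on UNIV"

abbreviation Y2 :: "(real \<Rightarrow> nat pmf) \<Rightarrow> real \<Rightarrow> model \<Rightarrow> model" where
  "Y2 \<equiv> Y2_on UNIV"

end

theory Submission
  imports Defs
begin

text \<open>
  The function \<open>h\<^sub>\<eta> = pgf (N \<eta>)\<close> has derivative \<open>Pr(N\<^sub>\<eta> = 1) = exp (- \<eta>)\<close> at \<open>0\<close>. By the
  chain rule, \<open>h\<^sub>a \<circ> h\<^sub>b\<close> has derivative \<open>exp (- (a + b))\<close> there. Since it is the pgf of a member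
  of the model, and the members are told apart by this derivative, it is \<open>h\<close> at \<open>a + b\<close>
  (\<open>eta_pgf_compose\<close>). Thus the pgfs form a semigroup that is
  isomorphic to \<open>{\<eta>0..}\<close> with addition; in particular they commute. They are increasing
  bijections of \<open>{0..1}\<close>, so the semigroup embeds in its group of quotients
  \<open>H\<^bsub>a - b\<^esub> = h\<^sub>a \<circ> h\<^sub>b\<^sup>-\<^sup>1\<close>, which is a one-parameter group because every real number is a
  difference of two elements of \<open>{\<eta>0..}\<close> (\<open>unit_flow_H_fun\<close>). Conjugation by
  \<open>t \<mapsto> 1 - t\<close> turns it into a second one-parameter group.

  The rest is about sets of real numbers. Letting a one-parameter group act on a model with
  parameters in \<open>S\<close>, and then with parameters in \<open>R\<close>, is the same as letting it act with
  parameters in \<open>R + S\<close> (\<open>orbit_orbit\<close>). The basic transformations are the actions of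
  \<open>{\<eta>0..}\<close> and \<open>{..- \<eta>0}\<close>, the extensions are the actions of \<open>UNIV\<close>, and all claims follow
  from \<open>{\<eta>0..} + {..- \<eta>0} = UNIV\<close>, from \<open>R + UNIV = UNIV\<close> for nonempty \<open>R\<close>, and from the fact
  that the parameter \<open>0\<close> acts as the identity.
\<close>

section \<open>Increasing bijections of the unit interval\<close>

definition unit_automorphism :: "(real \<Rightarrow> real) \<Rightarrow> bool" where
  "unit_automorphism f \<longleftrightarrow>
     continuous_on {0..1} f \<and> strict_mono_on {0..1} f \<and> f 0 = 0 \<and> f 1 = 1"

lemma unit_automorphism_mono:
  assumes "unit_automorphism f" "s \<in> {0..1}" "t \<in> {0..1}" "s \<le> t"
  shows "f s \<le> f t"
  using assms unfolding unit_automorphism_def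
  by (metis order_le_less strict_mono_onD)

lemma unit_automorphism_in_unit:
  assumes "unit_automorphism f" "t \<in> {0..1}"
  shows "f t \<in> {0..1}"
  using unit_automorphism_mono[OF assms(1), of 0 t] unit_automorphism_mono[OF assms(1), of t 1] assms
  by (auto simp: unit_automorphism_def)

lemma unit_automorphism_inj: "unit_automorphism f \<Longrightarrow> inj_on f {0..1}"
  unfolding unit_automorphism_def by (blast intro: strict_mono_on_imp_inj_on)

lemma unit_automorphism_image:
  assumes "unit_automorphism f"
  shows "f ` {0..1} = {0..1}"
proof
  show "f ` {0..1} \<subseteq> {0..1}" using unit_automorphism_in_unit[OF assms] by blast
  show "{0..1} \<subseteq> f ` {0..1}"
  proof
    fix y :: real assume "y \<in> {0..1}"
    then show "y \<in> f ` {0..1}"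
      using IVT'[of f 0 y 1] assms by (force simp: unit_automorphism_def)
  qed
qed

lemma unit_automorphism_inverse:
  assumes "unit_automorphism f" "t \<in> {0..1}"
  shows "inv_into {0..1} f t \<in> {0..1}" "f (inv_into {0..1} f t) = t"
proof -
  have "t \<in> f ` {0..1}" using assms(2) unfolding unit_automorphism_image[OF assms(1)] .
  then show "inv_into {0..1} f t \<in> {0..1}" "f (inv_into {0..1} f t) = t"
    using inv_into_into[of t f "{0..1}"] f_inv_into_f[of t f "{0..1}"] by blast+
qed

lemma unit_automorphism_compose:
  assumes f: "unit_automorphism f" and g: "unit_automorphism g"
  shows "unit_automorphism (\<lambda>t. f (g t))"
  unfolding unit_automorphism_def
proof (intro conjI)
  show "continuous_on {0..1} (\<lambda>t. f (g t))"
    using f g unit_automorphism_image[OF g]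
    by (intro continuous_on_compose2[of "{0..1}" f "{0..1}" g]) (simp_all add: unit_automorphism_def)
  show "strict_mono_on {0..1} (\<lambda>t. f (g t))"
    using f g unit_automorphism_in_unit[OF g]
    by (auto simp: unit_automorphism_def strict_mono_on_def)
qed (use f g in \<open>simp_all add: unit_automorphism_def\<close>)

lemma unit_automorphism_inv_into:
  assumes f: "unit_automorphism f"
  shows "unit_automorphism (inv_into {0..1} f)"
  unfolding unit_automorphism_def
proof (intro conjI)
  note inv = unit_automorphism_inverse[OF f]
  have "continuous_on (f ` {0..1}) (inv_into {0..1} f)"
    using f unit_automorphism_inj[OF f]
    by (intro continuous_on_inv) (auto simp: unit_automorphism_def)
  then show "continuous_on {0..1} (inv_into {0..1} f)"
    by (simp add: unit_automorphism_image[OF f])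
  show "strict_mono_on {0..1} (inv_into {0..1} f)"
  proof (rule strict_mono_onI)
    fix s t :: real assume "s \<in> {0..1}" "t \<in> {0..1}" "s < t"
    then show "inv_into {0..1} f s < inv_into {0..1} f t"
      using unit_automorphism_mono[OF f inv(1) inv(1), of t s] inv(2) by force
  qed
  have f01: "f 0 = 0" "f 1 = 1" using f by (simp_all add: unit_automorphism_def)
  have "inv_into {0..1} f (f 0) = 0" "inv_into {0..1} f (f 1) = 1"
    by (rule inv_into_f_f[OF unit_automorphism_inj[OF f]]; simp)+
  then show "inv_into {0..1} f 0 = 0" "inv_into {0..1} f 1 = 1"
    unfolding f01 .
qed

lemma unit_automorphism_conj:
  assumes "unit_automorphism f"
  shows "unit_automorphism (\<lambda>t. 1 - f (1 - t))"
  unfolding unit_automorphism_def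
proof (intro conjI)
  show "continuous_on {0..1} (\<lambda>t. 1 - f (1 - t))"
    using assms
    by (intro continuous_on_diff continuous_on_const continuous_on_compose2[of "{0..1}" f "{0..1}" "\<lambda>t. 1 - t"])
       (auto simp: unit_automorphism_def intro: continuous_on_op_minus)
  show "strict_mono_on {0..1} (\<lambda>t. 1 - f (1 - t))"
    using assms by (auto simp: unit_automorphism_def strict_mono_on_def)
qed (use assms in \<open>simp_all add: unit_automorphism_def\<close>)

lemma unit_automorphism_cong:
  assumes "unit_automorphism f" "\<And>t. t \<in> {0..1} \<Longrightarrow> g t = f t"
  shows "unit_automorphism g"
  unfolding unit_automorphism_def
proof (intro conjI)
  have f: "continuous_on {0..1} f" "strict_mono_on {0..1} f" "f 0 = 0" "f 1 = 1"
    using assms(1) unfolding unit_automorphism_def by auto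
  have "continuous_on {0..1} g = continuous_on {0..1} f"
    by (rule continuous_on_cong[OF refl]) (rule assms(2))
  then show "continuous_on {0..1} g" using f(1) by simp
  show "strict_mono_on {0..1} g"
  proof (rule strict_mono_onI)
    fix s t :: real assume st: "s \<in> {0..1}" "t \<in> {0..1}" "s < t"
    show "g s < g t"
      unfolding assms(2)[OF st(1)] assms(2)[OF st(2)] using strict_mono_onD[OF f(2) st] .
  qed
  show "g 0 = 0" "g 1 = 1"
    using f(3,4) assms(2)[of 0] assms(2)[of 1] by simp_all
qed

lemma stat_model_unit:
  assumes "stat_model X" "F \<in> X"
  shows "F x \<in> {0..1}"
proof -
  obtain M where M: "real_distribution M" and F: "F = cdf M"
    using assms by (auto simp: stat_model_def)
  interpret real_distribution M by (rule M)
  show ?thesis using cdf_nonneg cdf_bounded_prob by (simp add: F)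
qed

text \<open>Monotonicity, the behaviour at \<open>\<plusminus>\<infinity>\<close> and right continuity pass through a continuous increasing
  function that fixes \<open>0\<close> and \<open>1\<close>, and these properties characterize distribution functions.\<close>

lemma unit_automorphism_cdf:
  assumes f: "unit_automorphism f" and M: "real_distribution M"
  shows "\<exists>M'. real_distribution M' \<and> (\<lambda>x. f (cdf M x)) = cdf M'"
proof -
  interpret real_distribution M by (rule M)
  let ?G = "\<lambda>x. f (cdf M x)"
  have unit: "cdf M x \<in> {0..1}" for x
    using cdf_nonneg cdf_bounded_prob by simp
  have cont: "continuous_on {0..1} f" and f01: "f 0 = 0" "f 1 = 1"
    using f by (auto simp: unit_automorphism_def)
  have mono: "?G x \<le> ?G y" if "x \<le> y" for x y
    using unit_automorphism_mono[OF f unit unit] cdf_nondecreasing[OF that] by blast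
  have lim: "(?G \<longlongrightarrow> f l) A" if "(cdf M \<longlongrightarrow> l) A" "l \<in> {0..1}" for l A
    using continuous_on_tendsto_compose[OF cont that] unit by simp
  have rc: "continuous (at_right a) ?G" for a
    using lim[of "cdf M a"] cdf_is_right_cont[of a] unit unfolding continuous_within by blast
  have bot: "(?G \<longlongrightarrow> 0) at_bot" and top: "(?G \<longlongrightarrow> 1) at_top"
    using lim[OF cdf_lim_at_bot] lim[OF cdf_lim_at_top_prob] f01 by simp_all
  show ?thesis
    using real_distribution_interval_measure[of ?G, OF mono rc bot top]
      cdf_interval_measure[of ?G, OF mono rc bot] by metis
qed

section \<open>One-parameter groups acting on models\<close>

text \<open>The composition law is only required on \<open>{0..1}\<close>, where distribution functions take their values
  and where \<open>H_fun\<close> is meaningful.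
  That \<open>G 0\<close> is the identity there is a consequence: it is idempotent and injective.\<close>

definition unit_flow :: "(real \<Rightarrow> real \<Rightarrow> real) \<Rightarrow> bool" where
  "unit_flow G \<longleftrightarrow> (\<forall>a. unit_automorphism (G a)) \<and>
     (\<forall>a b. \<forall>t\<in>{0..1}. G a (G b t) = G (a + b) t)"

definition orbit :: "(real \<Rightarrow> real \<Rightarrow> real) \<Rightarrow> real set \<Rightarrow> model \<Rightarrow> model" where
  "orbit G R X = (\<Union>a\<in>R. (\<lambda>F x. G a (F x)) ` X)"

lemma unit_flow_zero:
  assumes "unit_flow G" "t \<in> {0..1}"
  shows "G 0 t = t"
proof (rule inj_onD[OF unit_automorphism_inj])
  show "unit_automorphism (G 0)" using assms by (simp add: unit_flow_def)
  then show "G 0 t \<in> {0..1}" using assms(2) by (rule unit_automorphism_in_unit)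
  show "G 0 (G 0 t) = G 0 t" using assms by (simp add: unit_flow_def)
qed (fact assms(2))

text \<open>The inverse is taken of a function that agrees with \<open>G a\<close> on the unit interval only, so that the
  lemma covers \<open>pgf_inv\<close> and \<open>conj_pgf_inv\<close> alike.\<close>

lemma unit_flow_inv_into:
  assumes G: "unit_flow G" and f: "\<And>t. t \<in> {0..1} \<Longrightarrow> f t = G a t" and t: "t \<in> {0..1}"
  shows "inv_into {0..1} f t = G (- a) t"
proof -
  have ua: "unit_automorphism (G b)" for b using G by (simp add: unit_flow_def)
  have "unit_automorphism f" using unit_automorphism_cong[OF ua f] .
  moreover have u: "G (- a) t \<in> {0..1}" using unit_automorphism_in_unit[OF ua t] .
  moreover have "f (G (- a) t) = t"
    using G t u by (simp add: f unit_flow_zero unit_flow_def)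
  ultimately show ?thesis
    using inv_into_f_f[OF unit_automorphism_inj] by metis
qed

lemma unit_flow_conj:
  assumes "unit_flow G"
  shows "unit_flow (\<lambda>a t. 1 - G a (1 - t))"
  unfolding unit_flow_def
proof (intro conjI allI ballI)
  fix a
  show "unit_automorphism (\<lambda>t. 1 - G a (1 - t))"
    using assms by (intro unit_automorphism_conj) (simp add: unit_flow_def)
next
  fix a b t :: real assume "t \<in> {0..1}"
  then have "G a (G b (1 - t)) = G (a + b) (1 - t)"
    using assms by (simp add: unit_flow_def)
  then show "1 - G a (1 - (1 - G b (1 - t))) = 1 - G (a + b) (1 - t)" by simp
qed

lemma stat_model_orbit:
  assumes "unit_flow G" "stat_model X"
  shows "stat_model (orbit G R X)"
  unfolding stat_model_def
proof
  fix K assume "K \<in> orbit G R X"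
  then obtain a F where K: "K = (\<lambda>x. G a (F x))" and "F \<in> X"
    unfolding orbit_def by (elim UN_E imageE)
  obtain M where M: "real_distribution M" and F: "F = cdf M"
    using bspec[OF assms(2)[unfolded stat_model_def] \<open>F \<in> X\<close>] by (elim exE conjE)
  have "unit_automorphism (G a)" using assms(1) by (simp add: unit_flow_def)
  from unit_automorphism_cdf[OF this M] show "\<exists>M. real_distribution M \<and> K = cdf M"
    unfolding K F .
qed

lemma Union_sums:
  "(\<Union>a\<in>R. \<Union>b\<in>S. A (a + b)) = (\<Union>c\<in>{a + b | a b. a \<in> R \<and> b \<in> S}. A c)"
  by auto

lemma orbit_orbit:
  assumes G: "unit_flow G" and X: "stat_model X"
  shows "orbit G R (orbit G S X) = orbit G {a + b | a b. a \<in> R \<and> b \<in> S} X"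
proof -
  have comp: "(\<lambda>F x. G a (G b (F x))) ` X = (\<lambda>F x. G (a + b) (F x)) ` X" for a b
  proof (intro image_cong refl ext)
    fix F x assume "F \<in> X"
    then have "F x \<in> {0..1}" by (rule stat_model_unit[OF X])
    then show "G a (G b (F x)) = G (a + b) (F x)" using G by (simp add: unit_flow_def)
  qed
  have "orbit G R (orbit G S X) = (\<Union>a\<in>R. \<Union>b\<in>S. (\<lambda>F x. G a (G b (F x))) ` X)"
    unfolding orbit_def by (simp only: image_UN image_image)
  also have "\<dots> = (\<Union>a\<in>R. \<Union>b\<in>S. (\<lambda>F x. G (a + b) (F x)) ` X)"
    by (simp only: comp)
  also have "\<dots> = orbit G {a + b | a b. a \<in> R \<and> b \<in> S} X"
    unfolding orbit_def by (rule Union_sums[of "\<lambda>c. (\<lambda>F x. G c (F x)) ` X"])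
  finally show ?thesis .
qed

lemma orbit_orbit_UNIV:
  assumes "unit_flow G" "stat_model X" "c \<in> R"
  shows "orbit G R (orbit G UNIV X) = orbit G UNIV X"
proof -
  have "d \<in> {a + b | a b. a \<in> R \<and> b \<in> UNIV}" for d
    by (rule CollectI, rule exI[of _ c], rule exI[of _ "d - c"]) (use assms(3) in simp)
  then have "{a + b | a b. a \<in> R \<and> b \<in> UNIV} = UNIV" by blast
  then show ?thesis by (simp add: orbit_orbit[OF assms(1,2)])
qed

lemma subset_orbit_UNIV:
  assumes "unit_flow G" "stat_model X"
  shows "X \<subseteq> orbit G UNIV X"
proof
  fix F assume "F \<in> X"
  then have "G 0 (F x) = F x" for x
    by (intro unit_flow_zero[OF assms(1)] stat_model_unit[OF assms(2)])
  then have "F \<in> (\<lambda>F x. G 0 (F x)) ` X"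
    using \<open>F \<in> X\<close> by (intro image_eqI[of _ _ F]) simp_all
  then show "F \<in> orbit G UNIV X" unfolding orbit_def by (rule UN_I[OF UNIV_I])
qed

text \<open>Both halves of the result are instances: \<open>U\<close> is a transformation that acts by the group
  elements from \<open>c\<close> on, \<open>V\<close> acts by their inverses.\<close>

lemma unit_flow_half_line_actions:
  assumes G: "unit_flow G"
    and U: "\<And>X. stat_model X \<Longrightarrow> U X = orbit G {c..} X"
    and V: "\<And>X. stat_model X \<Longrightarrow> V X = orbit G {..- c} X"
  shows "model_extension (orbit G UNIV)"
    and "statistically_stable (orbit G UNIV)"
    and "stat_model X \<Longrightarrow> orbit G UNIV X = V (U X)"
    and "stat_model X \<Longrightarrow> orbit G UNIV X = U (V X)"
    and "stat_model X \<Longrightarrow> invariant_under (orbit G UNIV X) U"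
    and "stat_model X \<Longrightarrow> invariant_under (orbit G UNIV X) V"
proof -
  note stat = stat_model_orbit[OF G]
  show "model_extension (orbit G UNIV)"
    unfolding model_extension_def model_transformation_def
    using stat subset_orbit_UNIV[OF G] by blast
  show "statistically_stable (orbit G UNIV)"
    unfolding statistically_stable_def using orbit_orbit_UNIV[OF G] by blast
  assume X: "stat_model X"
  \<comment> \<open>Both summands are chosen on their half-lines: \<open>d - \<bar>d\<bar> \<le> 0\<close>.\<close>
  have mem: "d \<in> {a + b | a b. a \<in> {c..} \<and> b \<in> {..- c}}" for d
    by (rule CollectI, rule exI[of _ "c + \<bar>d\<bar>"], rule exI[of _ "d - c - \<bar>d\<bar>"]) simp
  then have UNIV1: "{a + b | a b. a \<in> {c..} \<and> b \<in> {..- c}} = UNIV" by blast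
  then have UNIV2: "{a + b | a b. a \<in> {..- c} \<and> b \<in> {c..}} = UNIV"
    by (force simp: add.commute)
  show "orbit G UNIV X = U (V X)"
    using orbit_orbit[OF G X, of "{c..}" "{..- c}"]
    unfolding V[OF X] U[OF stat[OF X]] UNIV1 by simp
  show "orbit G UNIV X = V (U X)"
    using orbit_orbit[OF G X, of "{..- c}" "{c..}"]
    unfolding U[OF X] V[OF stat[OF X]] UNIV2 by simp
  show "invariant_under (orbit G UNIV X) U"
    unfolding invariant_under_def U[OF stat[OF X]] by (rule orbit_orbit_UNIV[OF G X, of c]) simp
  show "invariant_under (orbit G UNIV X) V"
    unfolding invariant_under_def V[OF stat[OF X]] by (rule orbit_orbit_UNIV[OF G X, of "- c"]) simp
qed

section \<open>Probability generating functions\<close>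

lemma pmf_nat_sums_1: "pmf (p :: nat pmf) sums 1"
  using sums_integral_count_space_nat[OF integrable_pmf[of UNIV p]]
  by (simp add: integral_pmf)

lemma pgf_summable:
  assumes "t \<in> {0..1}"
  shows "summable (\<lambda>i. pmf p i * t ^ i)"
proof (rule summable_comparison_test'[OF sums_summable[OF pmf_nat_sums_1[of p]]])
  fix n show "norm (pmf p n * t ^ n) \<le> pmf p n"
    using assms by (simp add: abs_mult mult_left_le power_le_one)
qed

text \<open>The sum of the probabilities dominates the series uniformly up to the boundary point \<open>1\<close>,
  where its radius of convergence may end.\<close>

lemma continuous_on_pgf: "continuous_on {0..1} (pgf p)"
proof -
  have "uniform_limit {0..1} (\<lambda>n t. \<Sum>i<n. pmf p i * t ^ i) (\<lambda>t. \<Sum>i. pmf p i * t ^ i) sequentially"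
  proof (rule Weierstrass_m_test[OF _ sums_summable[OF pmf_nat_sums_1[of p]]])
    fix n and t :: real assume "t \<in> {0..1}"
    then show "norm (pmf p n * t ^ n) \<le> pmf p n"
      by (simp add: abs_mult mult_left_le power_le_one)
  qed
  then have "continuous_on {0..1} (\<lambda>t. \<Sum>i. pmf p i * t ^ i)"
    by (rule uniform_limit_theorem[rotated]) (auto intro!: always_eventually continuous_intros)
  then show ?thesis unfolding pgf_def .
qed

lemma strict_mono_on_pgf:
  assumes "0 < pmf p 1"
  shows "strict_mono_on {0..1} (pgf p)"
proof (rule strict_mono_onI)
  fix s t :: real assume st: "s \<in> {0..1}" "t \<in> {0..1}" "s < t"
  note sm = pgf_summable[OF st(1), of p] pgf_summable[OF st(2), of p]
  have "0 < (\<Sum>i. pmf p i * t ^ i - pmf p i * s ^ i)"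
  proof (rule suminf_pos2[OF summable_diff[OF sm(2,1)]])
    fix i show "0 \<le> pmf p i * t ^ i - pmf p i * s ^ i"
      using st by (simp add: mult_left_mono power_mono)
    show "0 < pmf p 1 * t ^ 1 - pmf p 1 * s ^ 1"
      using assms st by simp
  qed
  then show "pgf p s < pgf p t"
    unfolding pgf_def suminf_diff[OF sm(2,1), symmetric] by simp
qed

lemma unit_automorphism_pgf:
  assumes "pmf p 0 = 0" "0 < pmf p 1"
  shows "unit_automorphism (pgf p)"
  unfolding unit_automorphism_def
  using continuous_on_pgf strict_mono_on_pgf[OF assms(2)] assms(1) pmf_nat_sums_1[of p]
  by (simp add: pgf_def sums_iff)

lemma DERIV_pgf_0: "(pgf p has_real_derivative pmf p 1) (at 0)"
  using termdiffs_strong[of "pmf p" 1 0] sums_summable[OF pmf_nat_sums_1[of p]]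
  by (simp add: pgf_def[abs_def] diffs_def)

text \<open>The chain rule at \<open>0\<close>, where pgfs without constant term have the derivative \<open>Pr(N = 1)\<close>.
  The identity is known on \<open>{0..1}\<close> only, so the derivatives compared are one-sided.\<close>

lemma pmf_1_compose:
  assumes q: "pmf q 0 = 0" and r: "\<And>t. t \<in> {0..1} \<Longrightarrow> pgf r t = pgf p (pgf q t)"
  shows "pmf r 1 = pmf p 1 * pmf q 1"
proof -
  have q0: "pgf q 0 = 0" using q by (simp add: pgf_def)
  have "(pgf r has_real_derivative pmf r 1) (at 0 within {0..1})"
    using DERIV_pgf_0 by (rule has_field_derivative_at_within)
  moreover have "((\<lambda>t. pgf p (pgf q t)) has_real_derivative pmf p 1 * pmf q 1) (at 0)"
    by (rule DERIV_chain2) (simp_all only: q0 DERIV_pgf_0)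
  then have "(pgf r has_real_derivative pmf p 1 * pmf q 1) (at 0 within {0..1})"
    by (rule has_field_derivative_transform_within[OF has_field_derivative_at_within zero_less_one])
       (simp_all add: r)
  moreover have "at 0 within {0..1::real} \<noteq> bot"
    by (simp add: trivial_limit_within islimpt_Icc)
  ultimately show ?thesis by (rule has_field_derivative_unique)
qed

section \<open>The group generated by a stopping model\<close>

text \<open>For pgfs, closure under composition means addition of the parameters, because the parameter
  can be read off from the derivative at \<open>0\<close>.\<close>

lemma eta_pgf_compose:
  assumes "stopping_model (N ` {\<eta>0..})" "closed_under_pgf_composition (N ` {\<eta>0..})"
    and "eta_parametrized N \<eta>0" "\<eta>0 \<le> a" "\<eta>0 \<le> b" "t \<in> {0..1}"
  shows "pgf (N a) (pgf (N b) t) = pgf (N (a + b)) t"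
proof -
  have param: "0 < pmf (N \<eta>) 1" "\<eta> = - ln (pmf (N \<eta>) 1)" if "\<eta>0 \<le> \<eta>" for \<eta>
    using assms(3) that unfolding eta_parametrized_def by blast+
  obtain c where c: "\<eta>0 \<le> c"
    and comp: "\<And>t. t \<in> {0..1} \<Longrightarrow> pgf (N c) t = pgf (N a) (pgf (N b) t)"
    using assms(2,4,5) unfolding closed_under_pgf_composition_def by fastforce
  have "pmf (N b) 0 = 0" using assms(1,5) by (simp add: stopping_model_def)
  from pmf_1_compose[OF this comp]
  have "- ln (pmf (N c) 1) = - ln (pmf (N a) 1) - ln (pmf (N b) 1)"
    using param(1)[OF assms(4)] param(1)[OF assms(5)] by (simp add: ln_mult)
  then have "c = a + b"
    using param(2)[OF c] param(2)[OF assms(4)] param(2)[OF assms(5)] by linarith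
  then show ?thesis using comp[OF assms(6)] by simp
qed

locale eta_stopping_model =
  fixes N :: "real \<Rightarrow> nat pmf" and \<eta>0 :: real
  assumes stopping: "stopping_model (N ` {\<eta>0..})"
    and closed: "closed_under_pgf_composition (N ` {\<eta>0..})"
    and eta: "eta_parametrized N \<eta>0"
begin

lemma unit_automorphism_eta_pgf:
  assumes "\<eta>0 \<le> a"
  shows "unit_automorphism (pgf (N a))"
proof (rule unit_automorphism_pgf)
  show "pmf (N a) 0 = 0" using stopping assms by (simp add: stopping_model_def)
  show "0 < pmf (N a) 1" using eta assms unfolding eta_parametrized_def by blast
qed

lemma pgf_pgf: "\<eta>0 \<le> a \<Longrightarrow> \<eta>0 \<le> b \<Longrightarrow> t \<in> {0..1} \<Longrightarrow> pgf (N a) (pgf (N b) t) = pgf (N (a + b)) t"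
  by (rule eta_pgf_compose[OF stopping closed eta])

lemma pgf_inv_unit:
  assumes "\<eta>0 \<le> a" "t \<in> {0..1}"
  shows "pgf_inv (N a) t \<in> {0..1}" "pgf (N a) (pgf_inv (N a) t) = t"
  unfolding pgf_inv_def
  using unit_automorphism_inverse[OF unit_automorphism_eta_pgf[OF assms(1)] assms(2)] .

text \<open>Two fractions with cross products \<open>h\<^sub>b \<circ> h\<^sub>c = h\<^sub>a \<circ> h\<^sub>d\<close> are equal in a commutative
  cancellative semigroup: applying the injective \<open>h\<^sub>b\<close> turns both sides into \<open>h\<^sub>a t\<close>.\<close>

lemma pgf_pgf_inv_cong:
  assumes ge: "\<eta>0 \<le> a" "\<eta>0 \<le> b" "\<eta>0 \<le> c" "\<eta>0 \<le> d" and eq: "a - b = c - d"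
    and t: "t \<in> {0..1}"
  shows "pgf (N a) (pgf_inv (N b) t) = pgf (N c) (pgf_inv (N d) t)"
proof (rule inj_onD[OF unit_automorphism_inj[OF unit_automorphism_eta_pgf[OF ge(2)]]])
  let ?s = "pgf_inv (N b) t" and ?u = "pgf_inv (N d) t"
  note s = pgf_inv_unit[OF ge(2) t] and u = pgf_inv_unit[OF ge(4) t]
  show "pgf (N a) ?s \<in> {0..1}" "pgf (N c) ?u \<in> {0..1}"
    using unit_automorphism_in_unit[OF unit_automorphism_eta_pgf[OF ge(1)] s(1)]
      unit_automorphism_in_unit[OF unit_automorphism_eta_pgf[OF ge(3)] u(1)] .
  have "pgf (N b) (pgf (N a) ?s) = pgf (N a) (pgf (N b) ?s)"
    using pgf_pgf[OF ge(2,1) s(1)] pgf_pgf[OF ge(1,2) s(1)] by (simp add: add.commute)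
  also have "\<dots> = pgf (N a) (pgf (N d) ?u)"
    using s(2) u(2) by simp
  also have "\<dots> = pgf (N b) (pgf (N c) ?u)"
    using pgf_pgf[OF ge(1,4) u(1)] pgf_pgf[OF ge(2,3) u(1)] eq by (simp add: algebra_simps)
  finally show "pgf (N b) (pgf (N a) ?s) = pgf (N b) (pgf (N c) ?u)" .
qed

lemma H_fun_diff:
  assumes "\<eta>0 \<le> a" "\<eta>0 \<le> b" "t \<in> {0..1}"
  shows "H_fun N \<eta>0 (a - b) t = pgf (N a) (pgf_inv (N b) t)"
  unfolding H_fun_def
proof (rule the_equality)
  show "\<exists>\<eta>1\<ge>\<eta>0. \<exists>\<eta>2\<ge>\<eta>0. a - b = \<eta>1 - \<eta>2 \<and>
      pgf (N a) (pgf_inv (N b) t) = pgf (N \<eta>1) (pgf_inv (N \<eta>2) t)"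
    using assms by (intro exI[of _ a] exI[of _ b] conjI refl)
next
  fix y
  assume "\<exists>\<eta>1\<ge>\<eta>0. \<exists>\<eta>2\<ge>\<eta>0. a - b = \<eta>1 - \<eta>2 \<and> y = pgf (N \<eta>1) (pgf_inv (N \<eta>2) t)"
  then obtain c d where "\<eta>0 \<le> c" "\<eta>0 \<le> d" "a - b = c - d"
    and y: "y = pgf (N c) (pgf_inv (N d) t)" by (elim exE conjE)
  then show "y = pgf (N a) (pgf_inv (N b) t)"
    unfolding y by (intro pgf_pgf_inv_cong[symmetric] assms)
qed

text \<open>To compose \<open>H\<^sub>a\<close> with \<open>H\<^sub>b\<close>, write them as fractions in which the denominator of the first
  cancels the numerator of the second: \<open>a = (a + y) - y\<close> and \<open>b = y - z\<close>, with \<open>z\<close> so large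
  that all three pgf parameters are at least \<open>\<eta>0\<close>.\<close>

lemma unit_flow_H_fun: "unit_flow (H_fun N \<eta>0)"
  unfolding unit_flow_def
proof (intro conjI allI ballI)
  fix a
  let ?b = "\<eta>0 + \<bar>a\<bar>"
  have ge: "\<eta>0 \<le> a + ?b" "\<eta>0 \<le> ?b" by auto
  have "unit_automorphism (\<lambda>t. pgf (N (a + ?b)) (pgf_inv (N ?b) t))"
    unfolding pgf_inv_def
    by (rule unit_automorphism_compose[OF unit_automorphism_eta_pgf[OF ge(1)]
          unit_automorphism_inv_into[OF unit_automorphism_eta_pgf[OF ge(2)]]])
  then show "unit_automorphism (H_fun N \<eta>0 a)"
    by (rule unit_automorphism_cong) (use H_fun_diff[OF ge] in simp)
next
  fix a b t :: real assume t: "t \<in> {0..1}"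
  define z where "z = \<eta>0 + \<bar>a\<bar> + \<bar>b\<bar>"
  define y where "y = b + z"
  have ge: "\<eta>0 \<le> z" "\<eta>0 \<le> y" "\<eta>0 \<le> a + y" unfolding z_def y_def by auto
  let ?s = "pgf_inv (N z) t"
  have s: "?s \<in> {0..1}" using pgf_inv_unit(1)[OF ge(1) t] .
  have "H_fun N \<eta>0 b t = pgf (N y) ?s"
    using H_fun_diff[OF ge(2,1) t] by (simp add: y_def)
  moreover have "pgf (N y) ?s \<in> {0..1}"
    using unit_automorphism_in_unit[OF unit_automorphism_eta_pgf[OF ge(2)] s] .
  ultimately have "H_fun N \<eta>0 a (H_fun N \<eta>0 b t) = pgf (N (a + y)) (pgf_inv (N y) (pgf (N y) ?s))"
    using H_fun_diff[OF ge(3,2)] by simp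
  also have "pgf_inv (N y) (pgf (N y) ?s) = ?s"
    unfolding pgf_inv_def[of "N y"]
    by (rule inv_into_f_f[OF unit_automorphism_inj[OF unit_automorphism_eta_pgf[OF ge(2)]] s])
  also have "pgf (N (a + y)) ?s = H_fun N \<eta>0 (a + b) t"
    using H_fun_diff[OF ge(3,1) t] by (simp add: y_def add.assoc)
  finally show "H_fun N \<eta>0 a (H_fun N \<eta>0 b t) = H_fun N \<eta>0 (a + b) t" .
qed

lemma pgf_eq_H_fun:
  assumes a: "\<eta>0 \<le> a" and t: "t \<in> {0..1}"
  shows "pgf (N a) t = H_fun N \<eta>0 a t"
proof -
  have "0 \<le> \<eta>0" using eta unfolding eta_parametrized_def by (rule conjunct1)
  \<comment> \<open>Even if \<open>\<eta>0 > 0\<close> and the model lacks the identity, \<open>h\<^sub>a = h\<^bsub>a + a\<^esub> \<circ> h\<^sub>a\<^sup>-\<^sup>1\<close>.\<close>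
  then have "H_fun N \<eta>0 ((a + a) - a) t = pgf (N (a + a)) (pgf_inv (N a) t)"
    using a t by (intro H_fun_diff) auto
  also have "\<dots> = pgf (N a) (pgf (N a) (pgf_inv (N a) t))"
    using pgf_pgf[OF a a pgf_inv_unit(1)[OF a t]] by simp
  finally show ?thesis using pgf_inv_unit(2)[OF a t] by simp
qed

lemma conj_pgf_eq_conj_H_fun: "\<eta>0 \<le> a \<Longrightarrow> t \<in> {0..1} \<Longrightarrow> conj_pgf (N a) t = conj_H_fun N \<eta>0 a t"
  using pgf_eq_H_fun[of a "1 - t"] by (simp add: conj_pgf_def conj_H_fun_def)

lemma unit_flow_conj_H_fun: "unit_flow (conj_H_fun N \<eta>0)"
  using unit_flow_conj[OF unit_flow_H_fun] unfolding conj_H_fun_def[abs_def] .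

lemma pgf_inv_eq_H_fun: "\<eta>0 \<le> a \<Longrightarrow> t \<in> {0..1} \<Longrightarrow> pgf_inv (N a) t = H_fun N \<eta>0 (- a) t"
  unfolding pgf_inv_def by (rule unit_flow_inv_into[OF unit_flow_H_fun pgf_eq_H_fun])

lemma conj_pgf_inv_eq_conj_H_fun:
  "\<eta>0 \<le> a \<Longrightarrow> t \<in> {0..1} \<Longrightarrow> conj_pgf_inv (N a) t = conj_H_fun N \<eta>0 (- a) t"
  unfolding conj_pgf_inv_def
  by (rule unit_flow_inv_into[OF unit_flow_conj_H_fun conj_pgf_eq_conj_H_fun])

end

section \<open>The transformations as actions of the group\<close>

lemma Collect_eq_Union_image: "{f a F | a F. a \<in> R \<and> F \<in> X} = (\<Union>a\<in>R. f a ` X)"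
  by blast

lemma Y1_on_eq_orbit: "Y1_on R N \<eta>0 = orbit (H_fun N \<eta>0) R"
  unfolding Y1_on_def[abs_def] orbit_def[abs_def] by (rule ext, rule Collect_eq_Union_image)

lemma Y2_on_eq_orbit: "Y2_on R N \<eta>0 = orbit (conj_H_fun N \<eta>0) R"
  unfolding Y2_on_def[abs_def] orbit_def[abs_def] by (rule ext, rule Collect_eq_Union_image)

text \<open>The functions that define the basic transformations agree with group elements on \<open>{0..1}\<close> only,
  which suffices on models of distribution functions. The reparametrization \<open>g\<close> is the identity for
  the pgfs and negation for their inverses.\<close>

lemma half_line_eq_orbit:
  assumes X: "stat_model X" and T: "\<And>a t. c \<le> a \<Longrightarrow> t \<in> {0..1} \<Longrightarrow> T a t = G (g a) t"
  shows "{\<lambda>x. T a (F x) | a F. c \<le> a \<and> F \<in> X} = orbit G (g ` {c..}) X"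
proof -
  have "{\<lambda>x. T a (F x) | a F. c \<le> a \<and> F \<in> X} = (\<Union>a\<in>{c..}. (\<lambda>F x. T a (F x)) ` X)"
    using Collect_eq_Union_image[of "\<lambda>a F x. T a (F x)" "{c..}" X] by simp
  also have "\<dots> = (\<Union>a\<in>{c..}. (\<lambda>F x. G (g a) (F x)) ` X)"
  proof (intro SUP_cong image_cong refl ext)
    fix a F x assume "a \<in> {c..}" "F \<in> X"
    then show "T a (F x) = G (g a) (F x)" using T stat_model_unit[OF X] by simp
  qed
  also have "\<dots> = orbit G (g ` {c..}) X"
    unfolding orbit_def by (simp only: image_image)
  finally show ?thesis .
qed

theorem proposition8:
  fixes N :: "real \<Rightarrow> nat pmf" and \<eta>0 :: real
  assumes "stopping_model (N ` {\<eta>0..})"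
    and "uniparametric (N ` {\<eta>0..})"
    and "closed_under_pgf_composition (N ` {\<eta>0..})"
    and "eta_parametrized N \<eta>0"
  shows
    "model_extension (Y1 N \<eta>0) \<and> model_extension (Y2 N \<eta>0) \<and>
     (\<forall>X. stat_model X \<longrightarrow>
        Y1 N \<eta>0 X = max_inv_trans N \<eta>0 (max_trans N \<eta>0 X) \<and>
        Y1 N \<eta>0 X = max_trans N \<eta>0 (max_inv_trans N \<eta>0 X) \<and>
        Y2 N \<eta>0 X = min_inv_trans N \<eta>0 (min_trans N \<eta>0 X) \<and>
        Y2 N \<eta>0 X = min_trans N \<eta>0 (min_inv_trans N \<eta>0 X)) \<and>
     statistically_stable (Y1 N \<eta>0) \<and> statistically_stable (Y2 N \<eta>0) \<and>
     (\<forall>X. stat_model X \<longrightarrow>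
        invariant_under (Y1 N \<eta>0 X) (max_trans N \<eta>0) \<and>
        invariant_under (Y1 N \<eta>0 X) (max_inv_trans N \<eta>0) \<and>
        invariant_under (Y2 N \<eta>0 X) (min_trans N \<eta>0) \<and>
        invariant_under (Y2 N \<eta>0 X) (min_inv_trans N \<eta>0)) \<and>
     (\<forall>X. stat_model X \<longrightarrow>
        max_trans N \<eta>0 X = Y1_on {\<eta>0..} N \<eta>0 X \<and>
        max_inv_trans N \<eta>0 X = Y1_on {..- \<eta>0} N \<eta>0 X \<and>
        min_trans N \<eta>0 X = Y2_on {\<eta>0..} N \<eta>0 X \<and>
        min_inv_trans N \<eta>0 X = Y2_on {..- \<eta>0} N \<eta>0 X)"
proof -
  interpret eta_stopping_model N \<eta>0
    using assms(1,3,4) by unfold_locales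
  have basic:
    "max_trans N \<eta>0 X = orbit (H_fun N \<eta>0) {\<eta>0..} X"
    "max_inv_trans N \<eta>0 X = orbit (H_fun N \<eta>0) {..- \<eta>0} X"
    "min_trans N \<eta>0 X = orbit (conj_H_fun N \<eta>0) {\<eta>0..} X"
    "min_inv_trans N \<eta>0 X = orbit (conj_H_fun N \<eta>0) {..- \<eta>0} X" if "stat_model X" for X
    unfolding max_trans_def max_inv_trans_def min_trans_def min_inv_trans_def
    using half_line_eq_orbit[where T = "\<lambda>a. pgf (N a)" and G = "H_fun N \<eta>0" and g = "\<lambda>a. a",
        OF that pgf_eq_H_fun]
      half_line_eq_orbit[where T = "\<lambda>a. pgf_inv (N a)" and G = "H_fun N \<eta>0" and g = uminus,
        OF that pgf_inv_eq_H_fun]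
      half_line_eq_orbit[where T = "\<lambda>a. conj_pgf (N a)" and G = "conj_H_fun N \<eta>0" and g = "\<lambda>a. a",
        OF that conj_pgf_eq_conj_H_fun]
      half_line_eq_orbit[where T = "\<lambda>a. conj_pgf_inv (N a)" and G = "conj_H_fun N \<eta>0" and g = uminus,
        OF that conj_pgf_inv_eq_conj_H_fun]
    by simp_all
  note max = unit_flow_half_line_actions[OF unit_flow_H_fun basic(1,2)]
    and min = unit_flow_half_line_actions[OF unit_flow_conj_H_fun basic(3,4)]
  show ?thesis
    unfolding Y1_on_eq_orbit Y2_on_eq_orbit
    by (intro conjI allI impI) ((rule max min basic; assumption)+)
qed

end
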